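(* Let $\mathcal{S}\subset\mathbb{N}^3$ be a simplicial semigroup generated by $\mathcal{A}=\{\mathbf{a}_1,\ldots,\mathbf{a}_n\}$ as in the context, so that $\Bbbk[\mathcal{S}]$ is a simplicial semigroup ring of Krull dimension $3$. The multigraded Hilbert series $\mathrm{HS}_{\Bbbk[\mathcal{S}]}(\mathbf{t})=\sum_{(s_1,s_2,s_3)\in\mathcal{S}}t_1^{s_1}t_2^{s_2}t_3^{s_3}$ of $\Bbbk[\mathcal{S}]$ is $$\mathrm{HS}_{\Bbbk[\mathcal{S}]}(\mathbf{t})=\frac{\sum_{\mathbf{s}\in\mathrm{AP}_{\mathcal{S}}}\mathbf{t}^{\mathbf{s}}-\sum_{\mathbf{s}\in E_{\mathcal{S}}^{3,1}}\mathbf{t}^{\mathbf{s}}-\sum_{\mathbf{s}\in E_{\mathcal{S}}^{2,0}}\mathbf{t}^{\mathbf{s}}-2\sum_{\mathbf{s}\in E_{\mathcal{S}}^{3,0}}\mathbf{t}^{\mathbf{s}}+\sum_{\mathbf{s}\in E_{\mathcal{S}}^{3,3}}\mathbf{t}^{\mathbf{s}}}{(1-t_1^{\omega_{n-2}})(1-t_2^{\omega_{n-1}})(1-t_3^{\omega_n})},$$ where $\omega_{n-2}=|\mathbf{e}_1|$, $\omega_{n-1}=|\mathbf{e}_2|$ and $\omega_n=|\mathbf{e}_3|$.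
   Context: Let $\Bbbk$ be an arbitrary field and $\mathcal{A}=\{\mathbf{a}_1,\ldots,\mathbf{a}_n\}\subset\mathbb{N}^3$ a finite set of nonzero vectors; $\mathcal{S}=\{\sum_i\lambda_i\mathbf{a}_i\mid\lambda_i\in\mathbb{N}\}$ is the affine monoid it spans. $\mathcal{S}$ is assumed simplicial, with extremal rays along the axes: $\mathbf{a}_{n-3+i}=\omega_{n-3+i}\,\boldsymbol\epsilon_i$ for $i=1,2,3$, where $\{\boldsymbol\epsilon_1,\boldsymbol\epsilon_2,\boldsymbol\epsilon_3\}$ is the canonical basis of $\mathbb{N}^3$ and $\omega_{n-2},\omega_{n-1},\omega_n\in\mathbb{Z}^+$. Put $\mathbf{e}_i=\mathbf{a}_{n-3+i}$, $i=1,2,3$. For a vector, $|\cdot|$ is the sum of its entries, and $\mathbf{t}^{\mathbf{s}}=t_1^{s_1}t_2^{s_2}t_3^{s_3}$. $\Bbbk[\mathcal{S}]=\Bbbk[\mathbf{t}^{\mathbf{s}}\mid\mathbf{s}\in\mathcal{S}]$ is the semigroup algebra. Apery set: $\mathrm{AP}_{\mathcal{S}}=\{\mathbf{s}\in\mathcal{S}\mid\mathbf{s}-\mathbf{e}_i\notin\mathcal{S}\text{ for all }i=1,2,3\}$. Exceptional sets (these and $\mathrm{AP}_{\mathcal{S}}$ are finite): - $E_{\mathcal{S}}^{3,1}$: all $\mathbf{s}\in\mathcal{S}$ with $\mathbf{s}-\mathbf{e}_j\in\mathcal{S}$ for all $j$ and such that, for some permutation $(i_1,i_2,i_3)$ of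 $(1,2,3)$, $\mathbf{s}-(\mathbf{e}_{i_1}+\mathbf{e}_{i_2})\in\mathcal{S}$, $\mathbf{s}-(\mathbf{e}_{i_1}+\mathbf{e}_{i_3})\notin\mathcal{S}$, $\mathbf{s}-(\mathbf{e}_{i_2}+\mathbf{e}_{i_3})\notin\mathcal{S}$. - $E_{\mathcal{S}}^{2,0}$: all $\mathbf{s}\in\mathcal{S}$ such that, for some permutation $(i_1,i_2,i_3)$ of $(1,2,3)$, $\mathbf{s}-\mathbf{e}_{i_1}\in\mathcal{S}$, $\mathbf{s}-\mathbf{e}_{i_2}\in\mathcal{S}$, $\mathbf{s}-\mathbf{e}_{i_3}\notin\mathcal{S}$ and $\mathbf{s}-(\mathbf{e}_{i_1}+\mathbf{e}_{i_2})\notin\mathcal{S}$. - $E_{\mathcal{S}}^{3,0}$: all $\mathbf{s}\in\mathcal{S}$ with $\mathbf{s}-\mathbf{e}_i\in\mathcal{S}$ for all $i$ and $\mathbf{s}-(\mathbf{e}_i+\mathbf{e}_j)\notin\mathcal{S}$ for all $i\ne j$. - $E_{\mathcal{S}}^{3,3}$: all $\mathbf{s}\in\mathcal{S}$ with $\mathbf{s}-\mathbf{e}_i\in\mathcal{S}$ for all $i$, $\mathbf{s}-(\mathbf{e}_i+\mathbf{e}_j)\in\mathcal{S}$ for all $i\ne j$, and $\mathbf{s}-(\mathbf{e}_1+\mathbf{e}_2+\mathbf{e}_3)\notin\mathcal{S}$. *)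

theory Defs
  imports
    "HOL-Analysis.Analysis"
    "HOL-Library.Poly_Mapping"
    "HOL-Combinatorics.Permutations"
    "HOL-Computational_Algebra.Computational_Algebra"
begin

definition affine_monoid :: "nat \<Rightarrow> (nat \<Rightarrow> nat ^ 3) \<Rightarrow> (nat ^ 3) set" where
  "affine_monoid n a = {\<Sum>i = 1..n. l i *s a i | l :: nat \<Rightarrow> nat. True}"

definition total_degree :: "nat ^ 3 \<Rightarrow> nat" where
  "total_degree v = (\<Sum>i\<in>UNIV. v $ i)"

text \<open>Subtraction on \<^typ>\<open>nat ^ 3\<close> truncates. The predicate below expresses that the difference
  of \<open>s\<close> and \<open>v\<close>, computed in the group of integer vectors, lies in \<open>S\<close>.\<close>

definition diff_mem :: "nat ^ 3 \<Rightarrow> nat ^ 3 \<Rightarrow> (nat ^ 3) set \<Rightarrow> bool" where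
  "diff_mem s v S \<longleftrightarrow> (\<exists>u\<in>S. u + v = s)"

text \<open>In the following sets, \<open>e 1\<close>, \<open>e 2\<close>, \<open>e 3\<close> are the generators on the extremal rays; other
  values of \<open>e\<close> are irrelevant.\<close>

definition apery_set :: "(nat ^ 3) set \<Rightarrow> (nat \<Rightarrow> nat ^ 3) \<Rightarrow> (nat ^ 3) set" where
  "apery_set S e = {s \<in> S. \<forall>i\<in>{1,2,3}. \<not> diff_mem s (e i) S}"

definition exceptional_31 :: "(nat ^ 3) set \<Rightarrow> (nat \<Rightarrow> nat ^ 3) \<Rightarrow> (nat ^ 3) set" where
  "exceptional_31 S e = {s \<in> S. (\<forall>j\<in>{1,2,3}. diff_mem s (e j) S) \<and>
     (\<exists>p. p permutes {1,2,3} \<and>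
        diff_mem s (e (p 1) + e (p 2)) S \<and>
        \<not> diff_mem s (e (p 1) + e (p 3)) S \<and>
        \<not> diff_mem s (e (p 2) + e (p 3)) S)}"

definition exceptional_20 :: "(nat ^ 3) set \<Rightarrow> (nat \<Rightarrow> nat ^ 3) \<Rightarrow> (nat ^ 3) set" where
  "exceptional_20 S e = {s \<in> S. \<exists>p. p permutes {1,2,3} \<and>
     diff_mem s (e (p 1)) S \<and> diff_mem s (e (p 2)) S \<and>
     \<not> diff_mem s (e (p 3)) S \<and> \<not> diff_mem s (e (p 1) + e (p 2)) S}"

definition exceptional_30 :: "(nat ^ 3) set \<Rightarrow> (nat \<Rightarrow> nat ^ 3) \<Rightarrow> (nat ^ 3) set" where
  "exceptional_30 S e = {s \<in> S. (\<forall>i\<in>{1,2,3}. diff_mem s (e i) S) \<and>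
     (\<forall>i\<in>{1,2,3}. \<forall>j\<in>{1,2,3}. i \<noteq> j \<longrightarrow> \<not> diff_mem s (e i + e j) S)}"

definition exceptional_33 :: "(nat ^ 3) set \<Rightarrow> (nat \<Rightarrow> nat ^ 3) \<Rightarrow> (nat ^ 3) set" where
  "exceptional_33 S e = {s \<in> S. (\<forall>i\<in>{1,2,3}. diff_mem s (e i) S) \<and>
     (\<forall>i\<in>{1,2,3}. \<forall>j\<in>{1,2,3}. i \<noteq> j \<longrightarrow> diff_mem s (e i + e j) S) \<and>
     \<not> diff_mem s (e 1 + e 2 + e 3) S}"

text \<open>Power series in three variables over the integers are iterated univariate series: \<open>t1\<close> is
  the variable of the outermost layer and \<open>t3\<close> that of the innermost one.\<close>

type_synonym series3 = "int fps fps fps"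

definition t1 :: series3 where "t1 = fps_X"
definition t2 :: series3 where "t2 = fps_const fps_X"
definition t3 :: series3 where "t3 = fps_const (fps_const fps_X)"

definition tpow :: "nat ^ 3 \<Rightarrow> series3" where
  "tpow s = t1 ^ (s $ 1) * t2 ^ (s $ 2) * t3 ^ (s $ 3)"

definition series_of_coeffs :: "(nat ^ 3 \<Rightarrow> int) \<Rightarrow> series3" where
  "series_of_coeffs c =
     Abs_fps (\<lambda>i. Abs_fps (\<lambda>j. Abs_fps (\<lambda>k. c (vector [i, j, k]))))"

text \<open>The formal (in general infinite) sum of the monomials \<open>tpow s\<close> over \<open>s \<in> B\<close>.\<close>

definition monomial_series :: "(nat ^ 3) set \<Rightarrow> series3" where
  "monomial_series B = series_of_coeffs (\<lambda>s. if s \<in> B then 1 else 0)"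

text \<open>The polynomial ring in three variables is the type of finitely supported functions on
  exponent vectors; the semigroup algebra consists of the polynomials supported in \<open>S\<close>.\<close>

definition semigroup_algebra :: "(nat ^ 3) set \<Rightarrow> (nat ^ 3 \<Rightarrow>\<^sub>0 'k::field) set" where
  "semigroup_algebra S = {f. Poly_Mapping.keys f \<subseteq> S}"

definition graded_component ::
    "(nat ^ 3 \<Rightarrow>\<^sub>0 'k::field) set \<Rightarrow> nat ^ 3 \<Rightarrow> (nat ^ 3 \<Rightarrow>\<^sub>0 'k) set" where
  "graded_component R s = {f \<in> R. Poly_Mapping.keys f \<subseteq> {s}}"

definition poly_scale :: "'k::field \<Rightarrow> (nat ^ 3 \<Rightarrow>\<^sub>0 'k) \<Rightarrow> (nat ^ 3 \<Rightarrow>\<^sub>0 'k)" where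
  "poly_scale c f = Poly_Mapping.map ((*) c) f"

definition hilbert_series :: "(nat ^ 3 \<Rightarrow>\<^sub>0 'k::field) set \<Rightarrow> series3" where
  "hilbert_series R =
     series_of_coeffs (\<lambda>s. int (vector_space.dim poly_scale (graded_component R s)))"

end

theory Submission
  imports Defs
begin

text \<open>Multiplying the series of \<open>S\<close> by the denominator gives, at \<open>s\<close>, the alternating sum over the
  subsets \<open>T\<close> of \<open>{1, 2, 3}\<close> with \<open>s - (\<Sum>i\<in>T. e i) \<in> S\<close>. These \<open>T\<close> form a simplicial complex because
  \<open>S\<close> is a monoid, and running through the complexes on at most three vertices shows that the sum
  vanishes unless \<open>s\<close> lies in one of the five sets of the numerator.

  The five sets are finite: if the alternating sum at \<open>s\<close> is nonzero, the complex is not a cone with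
  apex \<open>k\<close>, so \<open>s = u + v\<close> with \<open>v\<close> bounded, \<open>u \<in> S\<close> and \<open>u - e k \<notin> S\<close>. The last condition bounds
  the \<open>k\<close>-th coordinate of \<open>u\<close>.\<close>

section \<open>Coefficients of three-variable power series and multiplication by monomials\<close>

abbreviation coeff3 :: "series3 \<Rightarrow> nat \<Rightarrow> nat \<Rightarrow> nat \<Rightarrow> int" where
  "coeff3 f i j k \<equiv> fps_nth (fps_nth (fps_nth f i) j) k"

lemma coeff3_series_of_coeffs [simp]: "coeff3 (series_of_coeffs c) i j k = c (vector [i, j, k])"
  by (simp add: series_of_coeffs_def)

lemma monomial_series_eq: "monomial_series B = series_of_coeffs (\<lambda>s. of_bool (s \<in> B))"
  by (simp add: monomial_series_def of_bool_def)

lemma series_of_coeffs_add: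
  "series_of_coeffs c + series_of_coeffs d = series_of_coeffs (\<lambda>s. c s + d s)"
  by (simp add: fps_eq_iff)

lemma series_of_coeffs_diff:
  "series_of_coeffs c - series_of_coeffs d = series_of_coeffs (\<lambda>s. c s - d s)"
  by (simp add: fps_eq_iff)

lemma tpow_add: "tpow (u + v) = tpow u * tpow v"
  by (simp add: tpow_def power_add algebra_simps)

lemma tpow_0 [simp]: "tpow 0 = 1"
  by (simp add: tpow_def)

lemma coeff3_mult_tpow:
  "coeff3 (f * tpow v) i j k =
     (if v $ 1 \<le> i \<and> v $ 2 \<le> j \<and> v $ 3 \<le> k
      then coeff3 f (i - v $ 1) (j - v $ 2) (k - v $ 3) else 0)"
proof -
  \<comment> \<open>The variables are regrouped from outermost to innermost, so that the shift rule
    for powers of \<open>fps_X\<close> can be applied one layer after the other.\<close>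
  have *: "f * tpow v = f * fps_X ^ (v $ 1) * fps_const (fps_X ^ (v $ 2) * fps_const (fps_X ^ (v $ 3)))"
    by (simp add: tpow_def t1_def t2_def t3_def mult.assoc flip: fps_const_mult)
  show ?thesis
    unfolding * by (simp add: fps_X_power_mult_right_nth flip: mult.assoc)
qed

text \<open>Multiplication by \<open>tpow v\<close> translates the support by \<open>v\<close>. In
  the proof, the order conditions on the coordinates exclude truncated subtraction.\<close>

lemma monomial_series_mult_tpow:
  "monomial_series S * tpow v = series_of_coeffs (\<lambda>s. of_bool (diff_mem s v S))"
proof -
  have "diff_mem (vector [i, j, k]) v S \<longleftrightarrow>
      v $ 1 \<le> i \<and> v $ 2 \<le> j \<and> v $ 3 \<le> k \<and> vector [i - v $ 1, j - v $ 2, k - v $ 3] \<in> S" for i j k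
  proof -
    have "u + v = vector [i, j, k] \<longleftrightarrow> v $ 1 \<le> i \<and> v $ 2 \<le> j \<and> v $ 3 \<le> k \<and>
        u = vector [i - v $ 1, j - v $ 2, k - v $ 3]" for u :: "nat ^ 3"
      by (auto simp: vec_eq_iff forall_3)
    then show ?thesis
      by (auto simp: diff_mem_def)
  qed
  then show ?thesis
    unfolding fps_eq_iff coeff3_mult_tpow monomial_series_def coeff3_series_of_coeffs by auto
qed

lemma monomial_series_singleton: "monomial_series {s} = tpow s"
proof -
  have "monomial_series {0} = 1"
    by (auto simp: fps_eq_iff monomial_series_def vec_eq_iff forall_3 fps_one_nth)
  then have "tpow s = monomial_series {0} * tpow s"
    by simp
  also have "\<dots> = monomial_series {s}"
    unfolding monomial_series_mult_tpow
    by (auto simp: monomial_series_def diff_mem_def intro!: arg_cong[of _ _ series_of_coeffs])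
  finally show ?thesis ..
qed

lemma sum_tpow:
  assumes "finite B"
  shows "(\<Sum>s\<in>B. tpow s) = series_of_coeffs (\<lambda>s. of_bool (s \<in> B))"
  using assms
proof (induction B)
  case empty
  show ?case by (simp add: fps_eq_iff)
next
  case (insert x B)
  then show ?case
    by (auto simp: series_of_coeffs_add monomial_series_def simp flip: monomial_series_singleton
        intro!: arg_cong[of _ _ series_of_coeffs])
qed

text \<open>Some exponent in \<open>v\<close> is positive, so \<open>tpow v\<close> has constant
  coefficient 0 and \<open>1 - tpow v\<close> has constant coefficient 1.\<close>

lemma one_minus_tpow_neq_0:
  assumes "v \<noteq> 0"
  shows "1 - tpow v \<noteq> 0"
proof
  assume "1 - tpow v = 0"
  moreover have "coeff3 (tpow v) 0 0 0 = 0"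
    using assms coeff3_mult_tpow[of 1 v 0 0 0] by (auto simp: vec_eq_iff forall_3)
  ultimately show False
    by simp
qed

section \<open>The alternating sum over the faces of the complex\<close>

text \<open>The coefficient of \<open>tpow s\<close> in the series of \<open>S\<close> multiplied by \<open>1 - tpow (e i)\<close> for
  \<open>i = 1, 2, 3\<close>.\<close>

definition euler_char :: "(nat ^ 3) set \<Rightarrow> (nat \<Rightarrow> nat ^ 3) \<Rightarrow> nat ^ 3 \<Rightarrow> int" where
  "euler_char S e s = of_bool (s \<in> S)
     - of_bool (diff_mem s (e 1) S) - of_bool (diff_mem s (e 2) S) - of_bool (diff_mem s (e 3) S)
     + of_bool (diff_mem s (e 1 + e 2) S) + of_bool (diff_mem s (e 1 + e 3) S)
     + of_bool (diff_mem s (e 2 + e 3) S) - of_bool (diff_mem s (e 1 + e 2 + e 3) S)"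

lemma diff_mem_0 [simp]: "diff_mem s 0 S \<longleftrightarrow> s \<in> S"
  by (simp add: diff_mem_def)

lemma monomial_series_mult_denominator:
  "monomial_series S * ((1 - tpow (e 1)) * (1 - tpow (e 2)) * (1 - tpow (e 3))) =
     series_of_coeffs (euler_char S e)"
proof -
  let ?m = "\<lambda>v. monomial_series S * tpow v"
  have "monomial_series S * ((1 - tpow (e 1)) * (1 - tpow (e 2)) * (1 - tpow (e 3))) =
      ?m 0 - ?m (e 1) - ?m (e 2) - ?m (e 3) + ?m (e 1 + e 2) + ?m (e 1 + e 3) + ?m (e 2 + e 3)
      - ?m (e 1 + e 2 + e 3)"
    by (simp add: tpow_add algebra_simps)
  also have "\<dots> = series_of_coeffs (euler_char S e)"
    unfolding monomial_series_mult_tpow series_of_coeffs_add series_of_coeffs_diff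
      euler_char_def[abs_def] by simp
  finally show ?thesis .
qed

text \<open>Makes the permutations in the exceptional sets explicit. For the converse, an ordering
  is extended by the identity; mapping the finite set onto itself, it is injective there.\<close>

lemma ex_permutes_123:
  "(\<exists>p. p permutes {1, 2, 3::nat} \<and> P (p 1) (p 2) (p 3)) \<longleftrightarrow>
     P 1 2 3 \<or> P 1 3 2 \<or> P 2 1 3 \<or> P 2 3 1 \<or> P 3 1 2 \<or> P 3 2 1" (is "?L \<longleftrightarrow> ?R")
proof
  assume ?L
  then obtain p where p: "p permutes {1, 2, 3::nat}" "P (p 1) (p 2) (p 3)"
    by (elim exE conjE)
  have "p 1 \<in> {1, 2, 3}" "p 2 \<in> {1, 2, 3}" "p 3 \<in> {1, 2, 3}"
    by (simp_all only: permutes_in_image[OF p(1)]) simp_all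
  moreover have "p 1 \<noteq> p 2" "p 1 \<noteq> p 3" "p 2 \<noteq> p 3"
    by (simp_all add: inj_eq[OF permutes_inj[OF p(1)]])
  ultimately show ?R
    using p(2) by fastforce
next
  have *: ?L if "{i, j, k} = {1, 2, 3}" "P i j k" for i j k
  proof -
    let ?p = "id(1 := i, 2 := j, 3 := k)"
    have "?p ` {1, 2, 3} = {1, 2, 3}"
      using that(1) by simp
    then have "bij_betw ?p {1, 2, 3} {1, 2, 3}"
      by (intro bij_betw_imageI eq_card_imp_inj_on) auto
    then have "?p permutes {1, 2, 3}"
      by (rule bij_imp_permutes) simp
    with that(2) show ?L
      by (intro exI[of _ ?p]) simp
  qed
  assume ?R
  then show ?L
    by (elim disjE) (rule *[rotated], assumption, simp add: insert_commute)+
qed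

lemma ball_distinct_123:
  "(\<forall>i\<in>{1, 2, 3::nat}. \<forall>j\<in>{1, 2, 3}. i \<noteq> j \<longrightarrow> Q i j) \<longleftrightarrow>
     Q 1 2 \<and> Q 1 3 \<and> Q 2 1 \<and> Q 2 3 \<and> Q 3 1 \<and> Q 3 2"
  by auto

text \<open>Downward closure of the complex: in \<open>s = u + (v + w)\<close> the summand
  \<open>w\<close> is absorbed into \<open>u\<close>.\<close>

lemma diff_mem_add_D:
  assumes "\<And>x. x \<in> S \<Longrightarrow> x + w \<in> S" "diff_mem s (v + w) S"
  shows "diff_mem s v S"
  using assms unfolding diff_mem_def by (metis add.assoc add.commute)

text \<open>The five sets are pairwise disjoint, and the sum takes the values 1, -1, -1, -2 and 1 on
  them. The second claim serves to deduce their finiteness from that of the support.\<close>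

lemma euler_char_cases:
  assumes closed: "\<And>x i. x \<in> S \<Longrightarrow> i \<in> {1, 2, 3} \<Longrightarrow> x + e i \<in> S"
  shows euler_char_eq: "euler_char S e s = of_bool (s \<in> apery_set S e)
      - of_bool (s \<in> exceptional_31 S e) - of_bool (s \<in> exceptional_20 S e)
      - 2 * of_bool (s \<in> exceptional_30 S e) + of_bool (s \<in> exceptional_33 S e)" (is ?A)
    and euler_char_nonzero: "s \<in> apery_set S e \<union> exceptional_31 S e \<union> exceptional_20 S e
      \<union> exceptional_30 S e \<union> exceptional_33 S e \<Longrightarrow> euler_char S e s \<noteq> 0" (is "?B \<Longrightarrow> ?C")
proof -
  have D: "diff_mem s v S" if "diff_mem s (v + e i) S" "i \<in> {1, 2, 3}" for v i
    using diff_mem_add_D[OF closed that(1)] that(2) by blast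
  have comm: "e 2 + e 1 = e 1 + e 2" "e 3 + e 1 = e 1 + e 3" "e 3 + e 2 = e 2 + e 3"
    by (simp_all add: ac_simps)
  let ?d = "\<lambda>v. diff_mem s v S"
  have mono: "s \<in> S \<or> \<not> ?d (e 1)" "s \<in> S \<or> \<not> ?d (e 2)" "s \<in> S \<or> \<not> ?d (e 3)"
    "?d (e 1) \<or> \<not> ?d (e 1 + e 2)" "?d (e 2) \<or> \<not> ?d (e 1 + e 2)"
    "?d (e 1) \<or> \<not> ?d (e 1 + e 3)" "?d (e 3) \<or> \<not> ?d (e 1 + e 3)"
    "?d (e 2) \<or> \<not> ?d (e 2 + e 3)" "?d (e 3) \<or> \<not> ?d (e 2 + e 3)"
    "?d (e 1 + e 2) \<or> \<not> ?d (e 1 + e 2 + e 3)" "?d (e 1 + e 3) \<or> \<not> ?d (e 1 + e 2 + e 3)"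
    "?d (e 2 + e 3) \<or> \<not> ?d (e 1 + e 2 + e 3)"
    using D[of 0 1] D[of 0 2] D[of 0 3] D[of "e 2" 1] D[of "e 1" 2] D[of "e 1" 3] D[of "e 3" 1]
      D[of "e 2" 3] D[of "e 3" 2] D[of "e 1 + e 2" 3] D[of "e 1 + e 3" 2] D[of "e 2 + e 3" 1]
    by (auto simp: ac_simps)
  \<comment> \<open>The conditions with a permutation are symmetric in its first two values, so six
    orderings collapse to three cases.\<close>
  have sets:
    "s \<in> apery_set S e \<longleftrightarrow> s \<in> S \<and> \<not> ?d (e 1) \<and> \<not> ?d (e 2) \<and> \<not> ?d (e 3)"
    "s \<in> exceptional_31 S e \<longleftrightarrow> s \<in> S \<and> ?d (e 1) \<and> ?d (e 2) \<and> ?d (e 3) \<and>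
       (?d (e 1 + e 2) \<and> \<not> ?d (e 1 + e 3) \<and> \<not> ?d (e 2 + e 3) \<or>
        ?d (e 1 + e 3) \<and> \<not> ?d (e 1 + e 2) \<and> \<not> ?d (e 2 + e 3) \<or>
        ?d (e 2 + e 3) \<and> \<not> ?d (e 1 + e 2) \<and> \<not> ?d (e 1 + e 3))"
    "s \<in> exceptional_20 S e \<longleftrightarrow> s \<in> S \<and>
       (?d (e 1) \<and> ?d (e 2) \<and> \<not> ?d (e 3) \<and> \<not> ?d (e 1 + e 2) \<or>
        ?d (e 1) \<and> ?d (e 3) \<and> \<not> ?d (e 2) \<and> \<not> ?d (e 1 + e 3) \<or>
        ?d (e 2) \<and> ?d (e 3) \<and> \<not> ?d (e 1) \<and> \<not> ?d (e 2 + e 3))"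
    "s \<in> exceptional_30 S e \<longleftrightarrow> s \<in> S \<and> ?d (e 1) \<and> ?d (e 2) \<and> ?d (e 3) \<and>
       \<not> ?d (e 1 + e 2) \<and> \<not> ?d (e 1 + e 3) \<and> \<not> ?d (e 2 + e 3)"
    "s \<in> exceptional_33 S e \<longleftrightarrow> s \<in> S \<and> ?d (e 1) \<and> ?d (e 2) \<and> ?d (e 3) \<and>
       ?d (e 1 + e 2) \<and> ?d (e 1 + e 3) \<and> ?d (e 2 + e 3) \<and> \<not> ?d (e 1 + e 2 + e 3)"
    unfolding apery_set_def exceptional_31_def exceptional_20_def exceptional_30_def
      exceptional_33_def mem_Collect_eq ball_distinct_123
      ex_permutes_123[of "\<lambda>i j k. ?d (e i + e j) \<and> \<not> ?d (e i + e k) \<and> \<not> ?d (e j + e k)"]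
      ex_permutes_123[of "\<lambda>i j k. ?d (e i) \<and> ?d (e j) \<and> \<not> ?d (e k) \<and> \<not> ?d (e i + e j)"]
    by (simp only: comm ball_simps simp_thms; blast)+
  \<comment> \<open>\<open>p\<close> stands for \<open>s \<in> S\<close>, and \<open>a\<close>, \<open>ab\<close>, \<open>abc\<close> etc. for the faces of the complex.\<close>
  have table: "of_bool p - of_bool a - of_bool b - of_bool c + of_bool ab + of_bool ac
        + of_bool bc - of_bool abc = of_bool ap - of_bool x31 - of_bool x20 - 2 * of_bool x30
        + (of_bool x33 :: int)"
      "ap \<or> x31 \<or> x20 \<or> x30 \<or> x33 \<Longrightarrow>
        of_bool ap - of_bool x31 - of_bool x20 - 2 * of_bool x30 + of_bool x33 \<noteq> (0 :: int)"
    if "p \<or> \<not> a" "p \<or> \<not> b" "p \<or> \<not> c" "a \<or> \<not> ab" "b \<or> \<not> ab" "a \<or> \<not> ac"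
      "c \<or> \<not> ac" "b \<or> \<not> bc" "c \<or> \<not> bc"
      "ab \<or> \<not> abc" "ac \<or> \<not> abc" "bc \<or> \<not> abc"
      "ap \<longleftrightarrow> p \<and> \<not> a \<and> \<not> b \<and> \<not> c"
      "x31 \<longleftrightarrow> p \<and> a \<and> b \<and> c \<and> (ab \<and> \<not> ac \<and> \<not> bc \<or> ac \<and> \<not> ab \<and> \<not> bc \<or> bc \<and> \<not> ab \<and> \<not> ac)"
      "x20 \<longleftrightarrow> p \<and> (a \<and> b \<and> \<not> c \<and> \<not> ab \<or> a \<and> c \<and> \<not> b \<and> \<not> ac \<or> b \<and> c \<and> \<not> a \<and> \<not> bc)"
      "x30 \<longleftrightarrow> p \<and> a \<and> b \<and> c \<and> \<not> ab \<and> \<not> ac \<and> \<not> bc"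
      "x33 \<longleftrightarrow> p \<and> a \<and> b \<and> c \<and> ab \<and> ac \<and> bc \<and> \<not> abc"
    for p a b c ab ac bc abc ap x31 x20 x30 x33
    \<comment> \<open>Vertices are split before edges, so that the premises discard edges with a
      missing endpoint.\<close>
    unfolding that(13-17) using that(1-12)
    by (cases a; cases b; cases c; simp; cases ab; cases ac; cases bc; simp)+
  note table = table[OF mono sets]
  show ?A
    unfolding euler_char_def by (rule table(1))
  then show ?C if ?B
    using table(2) that by simp
qed

text \<open>Otherwise adding \<open>e i\<close> would never leave the complex, and the faces with
  and without \<open>i\<close> would cancel in pairs. Only partial sums of
  \<open>e 1 + e 2 + e 3\<close> occur as \<open>v\<close>, hence the bound.\<close>

lemma euler_char_nonzero_ex:
  assumes closed: "\<And>x i. x \<in> S \<Longrightarrow> i \<in> {1, 2, 3} \<Longrightarrow> x + e i \<in> S"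
    and nz: "euler_char S e s \<noteq> 0" and i: "i \<in> {1, 2, 3}"
  shows "\<exists>v. (\<forall>m. v $ m \<le> (e 1 + e 2 + e 3) $ m) \<and> diff_mem s v S \<and> \<not> diff_mem s (v + e i) S"
proof (rule ccontr)
  assume "\<not> ?thesis"
  then have "diff_mem s (v + e i) S" if "diff_mem s v S" "\<forall>m. v $ m \<le> (e 1 + e 2 + e 3) $ m" for v
    using that by blast
  then have eq: "diff_mem s (v + e i) S \<longleftrightarrow> diff_mem s v S" if "\<forall>m. v $ m \<le> (e 1 + e 2 + e 3) $ m" for v
    using that diff_mem_add_D[OF closed, OF _ i] by blast
  have "euler_char S e s = 0"
    using i eq[of 0] eq[of "e 1"] eq[of "e 2"] eq[of "e 3"]
      eq[of "e 1 + e 2"] eq[of "e 1 + e 3"] eq[of "e 2 + e 3"]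
    by (elim insertE) (simp_all add: euler_char_def ac_simps)
  with nz show False
    by contradiction
qed

section \<open>Affine monoids and bounds on coordinates\<close>

lemma affine_monoidI: "x = (\<Sum>i = 1..n. l i *s a i) \<Longrightarrow> x \<in> affine_monoid n a"
  by (auto simp: affine_monoid_def)

lemma affine_monoid_0: "0 \<in> affine_monoid n a"
  by (rule affine_monoidI[where l = "\<lambda>_. 0"]) (simp add: vec_eq_iff)

lemma affine_monoid_add:
  assumes "x \<in> affine_monoid n a" "y \<in> affine_monoid n a"
  shows "x + y \<in> affine_monoid n a"
proof -
  obtain l m where "x = (\<Sum>i = 1..n. l i *s a i)" "y = (\<Sum>i = 1..n. m i *s a i)"
    using assms by (auto simp: affine_monoid_def)
  then have "x + y = (\<Sum>i = 1..n. (l i + m i) *s a i)"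
    by (simp add: sum.distrib)
  then show ?thesis
    by (rule affine_monoidI)
qed

lemma affine_monoid_scale:
  assumes "x \<in> affine_monoid n a"
  shows "c *s x \<in> affine_monoid n a"
proof (induction c)
  case 0
  show ?case by (simp add: affine_monoid_0)
next
  case (Suc c)
  have "Suc c *s x = x + c *s x"
    by (simp add: vec_eq_iff)
  with Suc assms show ?case
    by (simp add: affine_monoid_add)
qed

lemma affine_monoid_sum:
  assumes "\<And>i. i \<in> I \<Longrightarrow> f i \<in> affine_monoid n a"
  shows "sum f I \<in> affine_monoid n a"
  using assms
  by (induction I rule: infinite_finite_induct) (auto simp: affine_monoid_0 affine_monoid_add)

lemma affine_monoid_generator:
  assumes "i \<in> {1..n}"
  shows "a i \<in> affine_monoid n a"
proof -
  have "a i = (\<Sum>j = 1..n. (if j = i then 1 else 0) *s a j)"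
    using assms by (simp add: vec_eq_iff if_distrib[of "\<lambda>c. c * _"] cong: if_cong)
  then show ?thesis
    by (rule affine_monoidI)
qed

lemma affine_monoid_coordinate_bounded:
  fixes w :: "3 \<Rightarrow> nat"
  assumes pos: "\<And>k. w k > 0"
    and mem: "\<And>k. w k *s axis k 1 \<in> affine_monoid n a"
  shows "\<exists>M. \<forall>x\<in>affine_monoid n a. \<not> diff_mem x (w k *s axis k 1) (affine_monoid n a) \<longrightarrow> x $ k \<le> M"
proof (intro exI ballI impI)
  let ?S = "affine_monoid n a"
  \<comment> \<open>If \<open>a j\<close> has a nonzero \<open>k\<close>-th coordinate, then \<open>D *s a j\<close> is a sum of the axis generators in
    which the \<open>k\<close>-th one occurs. So \<open>a j\<close> is used at most \<open>D\<close> times in \<open>x\<close>.\<close>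
  define D where "D = (\<Prod>k\<in>UNIV. w k)"
  have dvd: "w m dvd D" for m
    unfolding D_def by (rule dvd_prodI) auto
  have "D > 0"
    using pos by (simp add: D_def prod_pos)
  have shift: "\<exists>y\<in>?S. D *s v = y + w k *s axis k 1" if "v $ k > 0" for v
  proof
    define c where "c m = D div w m * v $ m - of_bool (m = k)" for m
    \<comment> \<open>Positivity ensures that the natural subtraction of 1 at \<open>m = k\<close>
      in \<open>c\<close> does not truncate.\<close>
    have "D div w k * v $ k > 0"
      using that \<open>D > 0\<close> dvd pos by (simp add: div_greater_zero_iff dvd_imp_le)
    then have "c m + of_bool (m = k) = D div w m * v $ m" for m
      by (cases "m = k") (simp_all add: c_def)
    then have "c m * w m + of_bool (m = k) * w m = D div w m * v $ m * w m" for m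
      by (metis add_mult_distrib)
    also have "D div w m * v $ m * w m = D div w m * w m * v $ m" for m
      by (simp only: ac_simps)
    finally have c: "c m * w m + of_bool (m = k) * w m = D * v $ m" for m
      using dvd by simp
    have "(\<Sum>m\<in>UNIV. c m *s (w m *s axis m 1)) $ i = (\<Sum>m\<in>UNIV. if m = i then c m * w m else 0)" for i
      unfolding sum_component by (rule sum.cong) (auto simp: axis_def)
    moreover have "(w k *s axis k 1) $ i = of_bool (i = k) * w i" for i
      by (auto simp: axis_def)
    ultimately show "D *s v = (\<Sum>m\<in>UNIV. c m *s (w m *s axis m 1)) + w k *s axis k 1"
      unfolding vec_eq_iff vector_add_component using c by simp
    show "(\<Sum>m\<in>UNIV. c m *s (w m *s axis m 1)) \<in> ?S"
      by (intro affine_monoid_sum affine_monoid_scale mem)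
  qed
  fix x
  assume "x \<in> ?S" and nd: "\<not> diff_mem x (w k *s axis k 1) ?S"
  then obtain l where x: "x = (\<Sum>i = 1..n. l i *s a i)"
    by (auto simp: affine_monoid_def)
  \<comment> \<open>The factor \<open>a j $ k\<close> stays on both sides since the argument bounds
    \<open>l j\<close> only when this coordinate is positive.\<close>
  have "l j * a j $ k \<le> D * a j $ k" if j: "j \<in> {1..n}" for j
  proof (rule ccontr)
    assume "\<not> ?thesis"
    then have "a j $ k > 0" "l j > D"
      by (auto simp: not_le)
    then obtain y where y: "y \<in> ?S" "D *s a j = y + w k *s axis k 1"
      using shift by blast
    \<comment> \<open>What remains of \<open>x\<close> after removing \<open>D\<close> copies of
      \<open>a j\<close>; \<open>?z + y\<close> is then \<open>x\<close> minus the axis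
      generator.\<close>
    let ?z = "(l j - D) *s a j + (\<Sum>i\<in>{1..n} - {j}. l i *s a i)"
    have "x = l j *s a j + (\<Sum>i\<in>{1..n} - {j}. l i *s a i)"
      unfolding x using j by (simp add: sum.remove)
    also have "l j *s a j = (l j - D) *s a j + D *s a j"
      using \<open>l j > D\<close> by (simp flip: vector_sadd_rdistrib)
    finally have "?z + y + w k *s axis k 1 = x"
      by (simp add: y(2) ac_simps)
    moreover have "?z + y \<in> ?S"
      using j y(1)
      by (intro affine_monoid_add affine_monoid_sum affine_monoid_scale affine_monoid_generator) auto
    ultimately show False
      using nd by (auto simp: diff_mem_def)
  qed
  then show "x $ k \<le> (\<Sum>j = 1..n. D * a j $ k)"
    unfolding x sum_component vector_smult_component by (rule sum_mono)
qed


section \<open>Finiteness of the support of the alternating sum\<close>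

lemma finite_bounded_vec3: "finite {s :: nat ^ 3. \<forall>k. s $ k \<le> B k}"
proof (rule finite_subset)
  show "{s :: nat ^ 3. \<forall>k. s $ k \<le> B k} \<subseteq>
      (\<lambda>(i, j, k). vector [i, j, k]) ` ({..B 1} \<times> {..B 2} \<times> {..B 3})"
  proof
    fix s :: "nat ^ 3"
    assume "s \<in> {s. \<forall>k. s $ k \<le> B k}"
    moreover have "s = vector [s $ 1, s $ 2, s $ 3]"
      by (simp add: vec_eq_iff forall_3)
    ultimately show "s \<in> (\<lambda>(i, j, k). vector [i, j, k]) ` ({..B 1} \<times> {..B 2} \<times> {..B 3})"
      by (intro image_eqI[of _ _ "(s $ 1, s $ 2, s $ 3)"]) simp_all
  qed
qed simp

text \<open>Each coordinate \<open>k\<close> has its own decomposition \<open>s = u + v\<close>,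
  which bounds \<open>s $ k\<close> alone; the three bounds together confine \<open>s\<close> to a
  box.\<close>

lemma finite_euler_char_support:
  fixes w :: "nat \<Rightarrow> nat"
  assumes pos: "\<And>i. i \<in> {1, 2, 3} \<Longrightarrow> w i > 0"
    and e: "\<And>i. i \<in> {1, 2, 3} \<Longrightarrow> e i = w i *s axis (of_nat i) 1"
    and mem: "\<And>i. i \<in> {1, 2, 3} \<Longrightarrow> e i \<in> affine_monoid n a"
  shows "finite {s. euler_char (affine_monoid n a) e s \<noteq> 0}"
proof -
  let ?S = "affine_monoid n a"
  \<comment> \<open>Coordinates live in the three-element type, where 3 equals 0, while generators
    are labelled by naturals; \<open>idx\<close> chooses the representatives 1, 2, 3.\<close>
  define idx :: "3 \<Rightarrow> nat" where "idx k = (if k = 1 then 1 else if k = 2 then 2 else 3)" for k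
  have idx: "idx k \<in> {1, 2, 3}" for k
    by (simp add: idx_def)
  have "of_nat (idx k) = k" for k
    using exhaust_3[of k] by (auto simp: idx_def)
  then have ek: "w (idx k) *s axis k 1 = e (idx k)" for k
    using e[OF idx, of k] by simp
  have "\<exists>M. \<forall>x\<in>?S. \<not> diff_mem x (e (idx k)) ?S \<longrightarrow> x $ k \<le> M" for k
    using affine_monoid_coordinate_bounded[of "\<lambda>k. w (idx k)" n a k, unfolded ek,
        OF pos[OF idx] mem[OF idx]] .
  then obtain M where M: "x \<in> ?S \<Longrightarrow> \<not> diff_mem x (e (idx k)) ?S \<Longrightarrow> x $ k \<le> M k" for x k
    by metis
  have "s $ k \<le> M k + (e 1 + e 2 + e 3) $ k" if nz: "euler_char ?S e s \<noteq> 0" for s k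
  proof -
    obtain v where v: "v $ k \<le> (e 1 + e 2 + e 3) $ k" "diff_mem s v ?S"
        "\<not> diff_mem s (v + e (idx k)) ?S"
      using euler_char_nonzero_ex[OF affine_monoid_add[OF _ mem] nz idx] by blast
    then obtain u where u: "u \<in> ?S" "u + v = s"
      by (auto simp: diff_mem_def)
    \<comment> \<open>Subtracting \<open>e (idx k)\<close> from \<open>u\<close> would amount to
      subtracting \<open>v + e (idx k)\<close> from \<open>s\<close>.\<close>
    have "\<not> diff_mem u (e (idx k)) ?S"
      using v(3) u(2) unfolding diff_mem_def by (metis add.assoc add.commute)
    then have "u $ k \<le> M k"
      using M u(1) by blast
    then show ?thesis
      using v(1) u(2) by auto
  qed
  then show ?thesis
    by (intro finite_subset[OF _ finite_bounded_vec3[of "\<lambda>k. M k + (e 1 + e 2 + e 3) $ k"]]) blast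
qed

section \<open>The semigroup algebra and its Hilbert series\<close>

lemma lookup_poly_scale [simp]: "Poly_Mapping.lookup (poly_scale c f) k = c * Poly_Mapping.lookup f k"
  by (simp add: poly_scale_def Poly_Mapping.map.rep_eq when_def)

lemma vector_space_poly_scale: "vector_space poly_scale"
  by unfold_locales (auto intro!: poly_mapping_eqI simp: lookup_add algebra_simps)

text \<open>The component is the line spanned by the monomial with exponent \<open>s\<close>, or
  zero, whatever the field.\<close>

lemma dim_graded_component:
  "vector_space.dim poly_scale (graded_component (semigroup_algebra S) s :: (nat ^ 3 \<Rightarrow>\<^sub>0 'k::field) set) =
     of_bool (s \<in> S)"
proof -
  interpret vs: vector_space "poly_scale :: 'k \<Rightarrow> _"
    by (rule vector_space_poly_scale)
  let ?V = "graded_component (semigroup_algebra S) s :: (nat ^ 3 \<Rightarrow>\<^sub>0 'k) set"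
  show ?thesis
  proof (cases "s \<in> S")
    case True
    let ?b = "Poly_Mapping.single s (1 :: 'k)"
    have "vs.dim ?V = 1"
    proof (rule vs.dim_unique[of "{?b}"])
      show "{?b} \<subseteq> ?V"
        using True by (simp add: graded_component_def semigroup_algebra_def)
      show "?V \<subseteq> vs.span {?b}"
      proof
        fix f assume "f \<in> ?V"
        then have "Poly_Mapping.lookup f t = 0" if "t \<noteq> s" for t
          using that by (auto simp: graded_component_def in_keys_iff)
        then have "f = poly_scale (Poly_Mapping.lookup f s) ?b"
          by (intro poly_mapping_eqI) (auto simp: lookup_single when_def)
        then show "f \<in> vs.span {?b}"
          by (metis insertI1 vs.span_base vs.span_scale)
      qed
      show "vs.independent {?b}"
        by (metis lookup_single_eq lookup_zero vs.dependent_single zero_neq_one)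
    qed simp
    with True show ?thesis by simp
  next
    case False
    have "vs.dim ?V = 0"
    proof (rule vs.dim_unique[of "{}"])
      show "?V \<subseteq> vs.span {}"
      proof
        fix f assume "f \<in> ?V"
        with False have "Poly_Mapping.keys f = {}"
          unfolding graded_component_def semigroup_algebra_def by blast
        then show "f \<in> vs.span {}"
          by simp
      qed
    qed (simp_all add: vs.independent_empty graded_component_def semigroup_algebra_def)
    with False show ?thesis by simp
  qed
qed

lemma hilbert_series_semigroup_algebra:
  "hilbert_series (semigroup_algebra S :: (nat ^ 3 \<Rightarrow>\<^sub>0 'k::field) set) = monomial_series S"
  by (simp add: hilbert_series_def monomial_series_eq dim_graded_component)

section \<open>The Hilbert series as a quotient\<close>

lemma total_degree_axis: "total_degree (c *s axis k 1) = c"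
  by (simp add: total_degree_def axis_def flip: sum_distrib_left)

lemma tpow_axis:
  "tpow (c *s axis 1 1) = t1 ^ c" "tpow (c *s axis 2 1) = t2 ^ c" "tpow (c *s axis 3 1) = t3 ^ c"
  by (simp_all add: tpow_def axis_def)

theorem corollary2p6:
  fixes n :: nat
    and a :: "nat \<Rightarrow> nat ^ 3"
    and \<omega> :: "nat \<Rightarrow> nat"
    and e :: "nat \<Rightarrow> nat ^ 3"
    and S :: "(nat ^ 3) set"
    and R :: "(nat ^ 3 \<Rightarrow>\<^sub>0 'k::field) set"
  assumes "n \<ge> 3"
    and "\<forall>i\<in>{1..n}. a i \<noteq> 0"
    and "\<forall>i\<in>{1,2,3}. \<omega> (n - 3 + i) > 0"
    and "\<forall>i\<in>{1,2,3}. a (n - 3 + i) = \<omega> (n - 3 + i) *s axis (of_nat i) 1"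
    and "\<forall>i\<in>{1,2,3}. e i = a (n - 3 + i)"
    and "S = affine_monoid n a"
    and "R = semigroup_algebra S"
  shows "hilbert_series R = monomial_series S \<and>
    to_fract (hilbert_series R) =
      to_fract ((\<Sum>s\<in>apery_set S e. tpow s)
              - (\<Sum>s\<in>exceptional_31 S e. tpow s)
              - (\<Sum>s\<in>exceptional_20 S e. tpow s)
              - 2 * (\<Sum>s\<in>exceptional_30 S e. tpow s)
              + (\<Sum>s\<in>exceptional_33 S e. tpow s))
      / to_fract ((1 - t1 ^ \<omega> (n - 2)) * (1 - t2 ^ \<omega> (n - 1)) * (1 - t3 ^ \<omega> n)) \<and>
    \<omega> (n - 2) = total_degree (e 1) \<and>
    \<omega> (n - 1) = total_degree (e 2) \<and>
    \<omega> n = total_degree (e 3)"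
proof -
  have idx: "n - 3 + 1 = n - 2" "n - 3 + 2 = n - 1" "n - 3 + 3 = n"
    using \<open>n \<ge> 3\<close> by simp_all
  have e: "e i = \<omega> (n - 3 + i) *s axis (of_nat i) 1" if "i \<in> {1, 2, 3}" for i
    using bspec[OF assms(4) that] bspec[OF assms(5) that] by simp
  have e1: "e 1 = \<omega> (n - 2) *s axis 1 1" and e2: "e 2 = \<omega> (n - 1) *s axis 2 1"
    and e3: "e 3 = \<omega> n *s axis 3 1"
    using e[of 1] e[of 2] e[of 3] unfolding idx by simp_all
  have mem: "e i \<in> S" if "i \<in> {1, 2, 3}" for i
  proof -
    have "n - 3 + i \<in> {1..n}"
      using that \<open>n \<ge> 3\<close> by auto
    then show ?thesis
      unfolding assms(6) bspec[OF assms(5) that] by (rule affine_monoid_generator)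
  qed
  have closed: "x + e i \<in> S" if "x \<in> S" "i \<in> {1, 2, 3}" for x i
    using that mem[OF that(2)] unfolding assms(6) by (intro affine_monoid_add)
  have "finite {s. euler_char S e s \<noteq> 0}"
    unfolding assms(6)
  proof (rule finite_euler_char_support)
    show "\<omega> (n - 3 + i) > 0" if "i \<in> {1, 2, 3}" for i
      using bspec[OF assms(3) that] .
  qed (use e mem assms(6) in simp_all)
  \<comment> \<open>The five sets lie in the finite support. Finiteness matters for the numerator: a
    sum over an infinite set would default to 0.\<close>
  then have "finite (apery_set S e \<union> exceptional_31 S e \<union> exceptional_20 S e
      \<union> exceptional_30 S e \<union> exceptional_33 S e)"
    by (rule rev_finite_subset) (intro subsetI CollectI euler_char_nonzero closed)
  then have fin: "finite (apery_set S e)" "finite (exceptional_31 S e)" "finite (exceptional_20 S e)"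
      "finite (exceptional_30 S e)" "finite (exceptional_33 S e)"
    by simp_all
  let ?N = "(\<Sum>s\<in>apery_set S e. tpow s) - (\<Sum>s\<in>exceptional_31 S e. tpow s)
    - (\<Sum>s\<in>exceptional_20 S e. tpow s) - 2 * (\<Sum>s\<in>exceptional_30 S e. tpow s)
    + (\<Sum>s\<in>exceptional_33 S e. tpow s)"
  let ?D = "(1 - t1 ^ \<omega> (n - 2)) * (1 - t2 ^ \<omega> (n - 1)) * (1 - t3 ^ \<omega> n)"
  have D: "?D = (1 - tpow (e 1)) * (1 - tpow (e 2)) * (1 - tpow (e 3))"
    by (simp only: e1 e2 e3 tpow_axis)
  have "e i \<noteq> 0" if "i \<in> {1, 2, 3}" for i
    using e[OF that] bspec[OF assms(3) that] by (auto simp: vec_eq_iff axis_def)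
  then have "?D \<noteq> 0"
    unfolding D by (simp only: mult_eq_0_iff one_minus_tpow_neq_0 insert_iff simp_thms)
  \<comment> \<open>\<open>mult_2\<close> turns the factor 2 into a repeated summand, so the rules
    for sums and differences merge everything into one coefficient function.\<close>
  have "?N = series_of_coeffs (euler_char S e)"
    unfolding mult_2 sum_tpow[OF fin(1)] sum_tpow[OF fin(2)] sum_tpow[OF fin(3)]
      sum_tpow[OF fin(4)] sum_tpow[OF fin(5)] series_of_coeffs_add series_of_coeffs_diff
    by (intro arg_cong[of _ _ series_of_coeffs] ext)
      (subst euler_char_eq, (fact closed | simp only: mult_2)+)
  then have "monomial_series S * ?D = ?N"
    by (simp only: D monomial_series_mult_denominator)
  \<comment> \<open>The identity holds as a product of power series; division takes place in the
    fraction field, where \<open>?D\<close> must be nonzero because division by zero yields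
    0.\<close>
  then have "to_fract (monomial_series S) * to_fract ?D = to_fract ?N"
    by (simp only: to_fract_mult[symmetric])
  then have "to_fract (monomial_series S) = to_fract ?N / to_fract ?D"
    using \<open>?D \<noteq> 0\<close> by (simp only: nonzero_eq_divide_eq to_fract_eq_0_iff not_False_eq_True)
  moreover have "hilbert_series R = monomial_series S"
    unfolding assms(7) by (rule hilbert_series_semigroup_algebra)
  ultimately show ?thesis
    by (simp only: e1 e2 e3 total_degree_axis)
qed

end
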